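(* Let $(\mathcal{P},\overline{E})$ be a radical curve parametrization with $\overline{E}=(E_1,\ldots,E_m)$, $E_i=\Delta_i^{e_i}-g_i(t,\Delta_1,\ldots,\Delta_{i-1})$. For $i=1,\ldots,m$ let $\varepsilon_i=\max\{e_i,\deg(g_i)\}$, where here $\deg(g_i)$ denotes the classical (unweighted) total degree of $g_i$ as a polynomial in $t,\Delta_1,\ldots,\Delta_{i-1}$. Then the number of points of $\overline{X(\mathcal{P})}$ that cannot be lifted to $\mathcal{A}_{\mathcal{P}}$ (i.e. points $\overline{x}\in\overline{X(\mathcal{P})}$ for which there is no $(t,\overline{\Delta})\in\mathbb{C}^{m+1}$ with $(t,\overline{\Delta},\overline{x})\in\mathcal{A}_{\mathcal{P}}$) is at most $\varepsilon_1\cdots\varepsilon_m$.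
   Context: **Radical curve parametrization.** Let $\mathbb{F}_0=\mathbb{C}(t)\subseteq\mathbb{F}_1\subseteq\cdots\subseteq\mathbb{F}_m$ be a radical tower: $\mathbb{F}_i=\mathbb{F}_{i-1}(\delta_i)$ with $\delta_i^{e_i}\in\mathbb{F}_{i-1}$, $e_i$ a positive integer. Write $\overline{\delta}=(\delta_1,\ldots,\delta_m)$ and $\overline{\Delta}=(\Delta_1,\ldots,\Delta_m)$ for corresponding variables. The defining polynomials of the $\delta_i$ are $E_i=\Delta_i^{e_i}-g_i(t,\Delta_1,\ldots,\Delta_{i-1})\in\mathbb{C}[t,\overline{\Delta}]$, where $g_i$ is a nonzero polynomial with $\deg_{\Delta_j}(g_i)<e_j$ for $j<i$, and $E_i(t,\overline{\delta})=0$. A radical curve parametrization is given by a tuple $\mathcal{P}(t,\overline{\Delta})=(p_1/q_1,\ldots,p_n/q_n)$ with $p_i,q_i\in\mathbb{C}[t,\overline{\Delta}]$, $q_i(t,\overline{\delta})\neq 0$, together with $\overline{E}=(E_1,\ldots,E_m)$, where the elements $x_i=p_i(t,\overline{\delta})/q_i(t,\overline{\delta})\in\mathbb{F}_m$ are not all constant (the Jacobian with respect to $t$ has rank one). **The sets involved.** $X(\mathcal{P})\subseteq\mathbb{C}^n$ is the set of all $\overline{x}\in\mathbb{C}^n$ for which there is $(t,\overline{\Delta})\in\mathbb{C}^{m+1}$ with $E_i(t,\overline{\Delta})=0$ for all $i$, $\mathcal{P}(t,\overline{\Delta})$ well defined (all $q_i(t,\overline{\Delta})\ne0$) and $\mathcal{P}(t,\overline{\Delta})=\overline{x}$;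 $\overline{X(\mathcal{P})}$ is its Zariski closure in $\mathbb{C}^n$. $\mathcal{D}_{\mathcal{P}}\subseteq\mathbb{C}^{m+n+2}$ is the algebraic set of points $(t,\overline{\Delta},\overline{x},z)$ satisfying $E_i(t,\overline{\Delta})=0$ ($i=1,\ldots,m$), $p_i(t,\overline{\Delta})-x_iq_i(t,\overline{\Delta})=0$ ($i=1,\ldots,n$), and $z\cdot\mathrm{lcm}(q_1,\ldots,q_n)(t,\overline{\Delta})-1=0$. $\mathcal{A}_{\mathcal{P}}\subseteq\mathbb{C}^{m+n+1}$ is the Zariski closure of the image of $\mathcal{D}_{\mathcal{P}}$ under $(t,\overline{\Delta},\overline{x},z)\mapsto(t,\overline{\Delta},\overline{x})$. *)

theory Defs
  imports
    Complex_Main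
    "HOL.Hull"
    "HOL-Library.Poly_Mapping"
    "HOL-Computational_Algebra.Computational_Algebra"
begin

section \<open>Multivariate polynomials over the complex numbers\<close>

text \<open>A monomial maps each variable (a natural number) to its exponent, and a polynomial maps each
  monomial to its coefficient.\<close>

type_synonym mpoly_cx = "(nat \<Rightarrow>\<^sub>0 nat) \<Rightarrow>\<^sub>0 complex"

definition mvars :: "mpoly_cx \<Rightarrow> nat set" where
  "mvars f = (\<Union>\<mu>\<in>Poly_Mapping.keys f. Poly_Mapping.keys \<mu>)"

definition poly_ring :: "nat \<Rightarrow> mpoly_cx set" where
  "poly_ring N = {f. mvars f \<subseteq> {..<N}}"

definition mvar :: "nat \<Rightarrow> mpoly_cx" where
  "mvar i = Poly_Mapping.single (Poly_Mapping.single i 1) 1"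

definition mtotal_degree :: "mpoly_cx \<Rightarrow> nat" where
  "mtotal_degree f =
     Max (insert 0 ((\<lambda>\<mu>. \<Sum>i\<in>Poly_Mapping.keys \<mu>. Poly_Mapping.lookup \<mu> i) ` Poly_Mapping.keys f))"

definition mdegree_in :: "nat \<Rightarrow> mpoly_cx \<Rightarrow> nat" where
  "mdegree_in j f = Max (insert 0 ((\<lambda>\<mu>. Poly_Mapping.lookup \<mu> j) ` Poly_Mapping.keys f))"

text \<open>Evaluation in a field extension; the map \<open>c\<close> embeds the coefficients.\<close>

definition meval_ext :: "(complex \<Rightarrow> 'a) \<Rightarrow> (nat \<Rightarrow> 'a) \<Rightarrow> mpoly_cx \<Rightarrow> 'a::field" where
  "meval_ext c v f =
     (\<Sum>\<mu>\<in>Poly_Mapping.keys f.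
        c (Poly_Mapping.lookup f \<mu>) * (\<Prod>i\<in>Poly_Mapping.keys \<mu>. v i ^ Poly_Mapping.lookup \<mu> i))"

text \<open>Points of $\mathbb{C}^N$ are lists of length \<open>N\<close>. The value is meaningful only if the list
  covers all variables of \<open>f\<close>.\<close>

definition meval :: "mpoly_cx \<Rightarrow> complex list \<Rightarrow> complex" where
  "meval f a = meval_ext (\<lambda>c. c) (\<lambda>i. a ! i) f"

definition is_lcm_in :: "mpoly_cx set \<Rightarrow> mpoly_cx set \<Rightarrow> mpoly_cx \<Rightarrow> bool" where
  "is_lcm_in R Q l \<longleftrightarrow>
     l \<in> R \<and> (\<forall>q\<in>Q. q dvd l) \<and> (\<forall>c\<in>R. (\<forall>q\<in>Q. q dvd c) \<longrightarrow> l dvd c)"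

section \<open>Zariski topology of affine space\<close>

definition algebraic_set :: "nat \<Rightarrow> complex list set \<Rightarrow> bool" where
  "algebraic_set N V \<longleftrightarrow>
     (\<exists>F \<subseteq> poly_ring N. V = {a. length a = N \<and> (\<forall>f\<in>F. meval f a = 0)})"

definition zariski_closure :: "nat \<Rightarrow> complex list set \<Rightarrow> complex list set" where
  "zariski_closure N S = algebraic_set N hull S"

section \<open>Radical towers\<close>

definition is_subfield :: "'a::field set \<Rightarrow> bool" where
  "is_subfield K \<longleftrightarrow>
     1 \<in> K \<and> (\<forall>x\<in>K. \<forall>y\<in>K. x - y \<in> K \<and> x * y \<in> K) \<and> (\<forall>x\<in>K. inverse x \<in> K)"

definition adjoin :: "'a::field set \<Rightarrow> 'a \<Rightarrow> 'a set" where
  "adjoin K d = is_subfield hull (insert d K)"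

text \<open>The type \<open>'a\<close> is an arbitrary field that contains the whole tower; \<open>\<iota>\<close> embeds
  $\mathbb{C}(t)$ into it.\<close>

primrec tower_field :: "(complex poly fract \<Rightarrow> 'a::field) \<Rightarrow> (nat \<Rightarrow> 'a) \<Rightarrow> nat \<Rightarrow> 'a set" where
  "tower_field \<iota> \<delta> 0 = range \<iota>"
| "tower_field \<iota> \<delta> (Suc i) = adjoin (tower_field \<iota> \<delta> i) (\<delta> (Suc i))"

locale radical_tower =
  fixes \<iota> :: "complex poly fract \<Rightarrow> 'a::field"
    and m :: nat
    and e :: "nat \<Rightarrow> nat"
    and \<delta> :: "nat \<Rightarrow> 'a"
  assumes hom_one: "\<iota> 1 = 1"
    and hom_add: "\<iota> (x + y) = \<iota> x + \<iota> y"
    and hom_mult: "\<iota> (x * y) = \<iota> x * \<iota> y"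
    and exponent_pos: "i \<in> {1..m} \<Longrightarrow> e i > 0"
    and radical: "i \<in> {1..m} \<Longrightarrow> \<delta> i ^ e i \<in> tower_field \<iota> \<delta> (i - 1)"

definition tower_const :: "(complex poly fract \<Rightarrow> 'a::field) \<Rightarrow> complex \<Rightarrow> 'a" where
  "tower_const \<iota> c = \<iota> (Fraction_Field.Fract [:c:] 1)"

text \<open>Variable \<open>0\<close> is $t$ and variable \<open>i\<close> is $\Delta_i$ for \<open>i \<ge> 1\<close>, so \<open>poly_ring (m + 1)\<close> is
  $\mathbb{C}[t,\Delta_1,\ldots,\Delta_m]$ and \<open>poly_ring i\<close> is
  $\mathbb{C}[t,\Delta_1,\ldots,\Delta_{i-1}]$.\<close>

definition tower_eval ::
  "(complex poly fract \<Rightarrow> 'a::field) \<Rightarrow> (nat \<Rightarrow> 'a) \<Rightarrow> mpoly_cx \<Rightarrow> 'a" where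
  "tower_eval \<iota> \<delta> f =
     meval_ext (tower_const \<iota>)
       (\<lambda>i. if i = 0 then \<iota> (Fraction_Field.Fract [:0, 1:] 1) else \<delta> i) f"

definition defpoly :: "(nat \<Rightarrow> nat) \<Rightarrow> (nat \<Rightarrow> mpoly_cx) \<Rightarrow> nat \<Rightarrow> mpoly_cx" where
  "defpoly e g i = mvar i ^ e i - g i"

section \<open>Radical curve parametrizations\<close>

locale radical_curve_parametrization = radical_tower \<iota> m e \<delta>
  for \<iota> :: "complex poly fract \<Rightarrow> 'a::field"
    and m :: nat
    and e :: "nat \<Rightarrow> nat"
    and \<delta> :: "nat \<Rightarrow> 'a" +
  fixes n :: nat
    and g p q :: "nat \<Rightarrow> mpoly_cx"
  assumes g_ring: "i \<in> {1..m} \<Longrightarrow> g i \<in> poly_ring i"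
    and g_nonzero: "i \<in> {1..m} \<Longrightarrow> g i \<noteq> 0"
    and g_reduced: "i \<in> {1..m} \<Longrightarrow> j \<in> {1..<i} \<Longrightarrow> mdegree_in j (g i) < e j"
    and defpoly_root: "i \<in> {1..m} \<Longrightarrow> tower_eval \<iota> \<delta> (defpoly e g i) = 0"
    and p_ring: "i \<in> {1..n} \<Longrightarrow> p i \<in> poly_ring (m + 1)"
    and q_ring: "i \<in> {1..n} \<Longrightarrow> q i \<in> poly_ring (m + 1)"
    and q_nonzero: "i \<in> {1..n} \<Longrightarrow> tower_eval \<iota> \<delta> (q i) \<noteq> 0"
    and nonconstant:
      "\<exists>i\<in>{1..n}. tower_eval \<iota> \<delta> (p i) / tower_eval \<iota> \<delta> (q i) \<notin> range (tower_const \<iota>)"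

text \<open>Below, \<open>E\<close>, \<open>p\<close>, \<open>q\<close> are indexed from \<open>1\<close>, whereas the coordinates of the list \<open>x\<close> are
  indexed from \<open>0\<close>.\<close>

definition X_set ::
  "nat \<Rightarrow> nat \<Rightarrow> (nat \<Rightarrow> mpoly_cx) \<Rightarrow> (nat \<Rightarrow> mpoly_cx) \<Rightarrow> (nat \<Rightarrow> mpoly_cx) \<Rightarrow> complex list set" where
  "X_set m n E p q =
     {x. length x = n \<and>
         (\<exists>t \<Delta>. length \<Delta> = m \<and>
            (\<forall>i\<in>{1..m}. meval (E i) (t # \<Delta>) = 0) \<and>
            (\<forall>i\<in>{1..n}. meval (q i) (t # \<Delta>) \<noteq> 0) \<and>
            (\<forall>i\<in>{1..n}. meval (p i) (t # \<Delta>) / meval (q i) (t # \<Delta>) = x ! (i - 1)))}"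

text \<open>The argument \<open>l\<close> stands for $\mathrm{lcm}(q_1,\ldots,q_n)$, which is determined only up to a
  nonzero constant factor.\<close>

definition D_set ::
  "nat \<Rightarrow> nat \<Rightarrow> (nat \<Rightarrow> mpoly_cx) \<Rightarrow> (nat \<Rightarrow> mpoly_cx) \<Rightarrow> (nat \<Rightarrow> mpoly_cx) \<Rightarrow> mpoly_cx
     \<Rightarrow> complex list set" where
  "D_set m n E p q l =
     {t # \<Delta> @ x @ [z] | t \<Delta> x z.
        length \<Delta> = m \<and> length x = n \<and>
        (\<forall>i\<in>{1..m}. meval (E i) (t # \<Delta>) = 0) \<and>
        (\<forall>i\<in>{1..n}. meval (p i) (t # \<Delta>) - x ! (i - 1) * meval (q i) (t # \<Delta>) = 0) \<and>
        z * meval l (t # \<Delta>) - 1 = 0}"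

definition A_set ::
  "nat \<Rightarrow> nat \<Rightarrow> (nat \<Rightarrow> mpoly_cx) \<Rightarrow> (nat \<Rightarrow> mpoly_cx) \<Rightarrow> (nat \<Rightarrow> mpoly_cx) \<Rightarrow> mpoly_cx
     \<Rightarrow> complex list set" where
  "A_set m n E p q l = zariski_closure (m + n + 1) (butlast ` D_set m n E p q l)"

end

theory Submission
  imports Defs "Jordan_Normal_Form.Determinant"
begin

text \<open>The radical variety is finite of degree at most $d = e_1\cdots e_m$ over the $t$-line, so every
  function $h$ that is linear in $x$ satisfies, on the graph of the parametrization, a relation
  $\sum_{j \le d} F_j(t) h^j = 0$ with $F_j$ not all zero. Let $L(h)$ be its leading coefficient as
  a polynomial in $t$. If $a$ lies in the closure of the image and $L(h(a)) \ne 0$, then $t$ is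
  integral over the local ring at $a$, the $\Delta_i$ are integral over $\mathbb{C}[t]$, and lying-over
  produces a preimage of $a$ in the closure of the graph. So $h$ maps the points that do not lift to
  roots of $L$, of which there are at most $d$, and $h$ can be chosen injective on any finite set.
  This gives the bound $e_1\cdots e_m \le \varepsilon_1\cdots\varepsilon_m$.\<close>

section \<open>Evaluation of polynomials and polynomial functions\<close>

definition monom_val :: "(nat \<Rightarrow> complex) \<Rightarrow> (nat \<Rightarrow>\<^sub>0 nat) \<Rightarrow> complex" where
  "monom_val v \<mu> = (\<Prod>i\<in>Poly_Mapping.keys \<mu>. v i ^ Poly_Mapping.lookup \<mu> i)"

abbreviation ev :: "(nat \<Rightarrow> complex) \<Rightarrow> mpoly_cx \<Rightarrow> complex" where
  "ev v \<equiv> meval_ext (\<lambda>c. c) v"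

lemma ev_altdef: "ev v f = (\<Sum>\<mu>\<in>Poly_Mapping.keys f. Poly_Mapping.lookup f \<mu> * monom_val v \<mu>)"
  by (simp add: meval_ext_def monom_val_def)

lemma monom_val_superset:
  assumes "finite A" "Poly_Mapping.keys \<mu> \<subseteq> A"
  shows "monom_val v \<mu> = (\<Prod>i\<in>A. v i ^ Poly_Mapping.lookup \<mu> i)"
  unfolding monom_val_def using assms
  by (intro prod.mono_neutral_left) (auto simp: in_keys_iff)

lemma monom_val_add: "monom_val v (\<mu> + \<nu>) = monom_val v \<mu> * monom_val v \<nu>"
proof -
  let ?A = "Poly_Mapping.keys \<mu> \<union> Poly_Mapping.keys \<nu>"
  have "monom_val v (\<mu> + \<nu>) = (\<Prod>i\<in>?A. v i ^ Poly_Mapping.lookup (\<mu> + \<nu>) i)"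
    by (rule monom_val_superset) (auto dest: subsetD[OF Poly_Mapping.keys_add])
  then show ?thesis
    by (simp add: monom_val_superset[of ?A] lookup_add power_add prod.distrib)
qed

lemma ev_add: "ev v (f + g) = ev v f + ev v g"
  unfolding ev_altdef
  by (rule setsum_keys_plus_distrib[where f = "\<lambda>\<mu> c. c * monom_val v \<mu>"])
    (simp_all add: algebra_simps)

lemma ev_single: "ev v (Poly_Mapping.single \<mu> c) = c * monom_val v \<mu>"
  by (simp add: ev_altdef)

lemma ev_0 [simp]: "ev v 0 = 0"
  by (simp add: ev_altdef)

lemma ev_sum: "ev v (sum f A) = (\<Sum>a\<in>A. ev v (f a))"
  by (induction A rule: infinite_finite_induct) (simp_all add: ev_add)

lemma sum_single_keys:
  "f = (\<Sum>\<mu>\<in>Poly_Mapping.keys f. Poly_Mapping.single \<mu> (Poly_Mapping.lookup f \<mu>))"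
  by (rule poly_mapping_eqI)
    (auto simp: lookup_sum lookup_single when_def in_keys_iff sum.delta' intro!: sum.neutral)

lemma ev_mult: "ev v (f * g) = ev v f * ev v g"
proof -
  have "ev v (f * g) = ev v ((\<Sum>\<mu>\<in>Poly_Mapping.keys f. Poly_Mapping.single \<mu> (Poly_Mapping.lookup f \<mu>)) *
      (\<Sum>\<mu>\<in>Poly_Mapping.keys g. Poly_Mapping.single \<mu> (Poly_Mapping.lookup g \<mu>)))"
    by (simp flip: sum_single_keys)
  also have "\<dots> = (\<Sum>\<mu>\<in>Poly_Mapping.keys f. \<Sum>\<nu>\<in>Poly_Mapping.keys g.
      Poly_Mapping.lookup f \<mu> * Poly_Mapping.lookup g \<nu> * (monom_val v \<mu> * monom_val v \<nu>))"
    by (simp add: sum_product ev_sum mult_single ev_single monom_val_add)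
  also have "\<dots> = ev v f * ev v g"
    by (simp add: sum_product ev_altdef mult_ac)
  finally show ?thesis .
qed

lemma ev_1 [simp]: "ev v 1 = 1"
  by (simp add: ev_altdef monom_val_def)

lemma ev_uminus: "ev v (- f) = - ev v f"
  using ev_add[of v f "- f"] by (simp add: add_eq_0_iff2)

lemma ev_diff: "ev v (f - g) = ev v f - ev v g"
  using ev_add[of v f "- g"] by (simp add: ev_uminus)

lemma ev_power: "ev v (f ^ k) = ev v f ^ k"
  by (induction k) (simp_all add: ev_mult)

lemma ev_prod: "ev v (prod f A) = (\<Prod>a\<in>A. ev v (f a))"
  by (induction A rule: infinite_finite_induct) (simp_all add: ev_mult)

lemma ev_mvar [simp]: "ev v (mvar i) = v i"
  by (simp add: mvar_def ev_single monom_val_def)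

text \<open>Polynomial maps on total assignments, with \<open>J\<close> bounding the coordinates
  they may read. Equality is that of functions, so regrouping by one variable, renaming variables
  and forming determinants need no bookkeeping of monomials.\<close>

inductive_set polyfun :: "nat set \<Rightarrow> ((nat \<Rightarrow> complex) \<Rightarrow> complex) set" for J where
  const: "(\<lambda>v. c) \<in> polyfun J"
| var: "i \<in> J \<Longrightarrow> (\<lambda>v. v i) \<in> polyfun J"
| add: "F \<in> polyfun J \<Longrightarrow> G \<in> polyfun J \<Longrightarrow> (\<lambda>v. F v + G v) \<in> polyfun J"
| mult: "F \<in> polyfun J \<Longrightarrow> G \<in> polyfun J \<Longrightarrow> (\<lambda>v. F v * G v) \<in> polyfun J"

lemma polyfun_sum: "(\<And>a. a \<in> A \<Longrightarrow> F a \<in> polyfun J) \<Longrightarrow> (\<lambda>v. \<Sum>a\<in>A. F a v) \<in> polyfun J"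
  by (induction A rule: infinite_finite_induct) (auto intro: polyfun.intros)

lemma polyfun_prod: "(\<And>a. a \<in> A \<Longrightarrow> F a \<in> polyfun J) \<Longrightarrow> (\<lambda>v. \<Prod>a\<in>A. F a v) \<in> polyfun J"
  by (induction A rule: infinite_finite_induct) (auto intro: polyfun.intros)

lemma polyfun_power: "F \<in> polyfun J \<Longrightarrow> (\<lambda>v. F v ^ k) \<in> polyfun J"
  by (induction k) (auto intro: polyfun.intros)

lemma polyfun_uminus: "F \<in> polyfun J \<Longrightarrow> (\<lambda>v. - F v) \<in> polyfun J"
  using polyfun.mult[OF polyfun.const[of "-1"], of F J] by simp

lemma polyfun_mono: "F \<in> polyfun J \<Longrightarrow> J \<subseteq> J' \<Longrightarrow> F \<in> polyfun J'"
  by (induction rule: polyfun.induct) (auto intro: polyfun.intros)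

lemma polyfun_cong: "F \<in> polyfun J \<Longrightarrow> (\<And>i. i \<in> J \<Longrightarrow> v i = w i) \<Longrightarrow> F v = F w"
  by (induction rule: polyfun.induct) auto

lemma ev_in_polyfun:
  assumes "mvars f \<subseteq> J"
  shows "(\<lambda>v. ev v f) \<in> polyfun J"
  unfolding meval_ext_def using assms
  by (intro polyfun_sum polyfun.mult polyfun.const polyfun_prod polyfun_power polyfun.var)
    (auto simp: mvars_def)

section \<open>From polynomial functions back to formal polynomials\<close>

lemma mvars_add: "mvars (f + g) \<subseteq> mvars f \<union> mvars g"
  using Poly_Mapping.keys_add[of f g] by (auto simp: mvars_def)

lemma mvars_mult: "mvars (f * g) \<subseteq> mvars f \<union> mvars g"
proof
  fix i assume "i \<in> mvars (f * g)"
  then obtain \<mu> where \<mu>: "\<mu> \<in> Poly_Mapping.keys (f * g)" "i \<in> Poly_Mapping.keys \<mu>"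
    by (auto simp: mvars_def)
  then obtain \<alpha> \<beta> where "\<mu> = \<alpha> + \<beta>" "\<alpha> \<in> Poly_Mapping.keys f" "\<beta> \<in> Poly_Mapping.keys g"
    using keys_mult[of f g] by auto
  with \<mu> Poly_Mapping.keys_add[of \<alpha> \<beta>] show "i \<in> mvars f \<union> mvars g"
    by (auto simp: mvars_def)
qed

lemma mvars_prod: "(\<And>a. a \<in> A \<Longrightarrow> mvars (f a) \<subseteq> J) \<Longrightarrow> mvars (prod f A) \<subseteq> J"
proof (induction A rule: infinite_finite_induct)
  case (insert a A)
  then have "mvars (f a) \<union> mvars (prod f A) \<subseteq> J" by simp
  with insert.hyps show ?case
    using order_trans[OF mvars_mult[of "f a" "prod f A"]] by simp
qed (auto simp: mvars_def)

text \<open>Algebraic sets are cut out by formal polynomials; together with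
  \<open>ev_in_polyfun\<close> this makes vanishing of polynomial functions interchangeable with
  vanishing of formal polynomials.\<close>

lemma polyfun_is_ev:
  assumes "F \<in> polyfun J"
  obtains f where "mvars f \<subseteq> J" "\<And>v. F v = ev v f"
proof -
  from assms have "\<exists>f. mvars f \<subseteq> J \<and> (\<forall>v. F v = ev v f)"
  proof induction
    case (const c)
    show ?case
      by (rule exI[of _ "Poly_Mapping.single 0 c"]) (simp add: ev_single monom_val_def mvars_def)
  next
    case (var i)
    then have "mvars (mvar i) \<subseteq> J" by (auto simp: mvars_def mvar_def)
    then show ?case by (intro exI[of _ "mvar i"]) simp
  next
    case (add F G)
    then obtain f g where "mvars f \<subseteq> J" "\<And>v. F v = ev v f" "mvars g \<subseteq> J" "\<And>v. G v = ev v g"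
      by auto
    then show ?case
      using mvars_add[of f g] by (intro exI[of _ "f + g"]) (auto simp: ev_add)
  next
    case (mult F G)
    then obtain f g where "mvars f \<subseteq> J" "\<And>v. F v = ev v f" "mvars g \<subseteq> J" "\<And>v. G v = ev v g"
      by auto
    then show ?case
      using mvars_mult[of f g] by (intro exI[of _ "f * g"]) (auto simp: ev_mult)
  qed
  then show ?thesis using that by blast
qed

text \<open>Induction over the generators, with a Cauchy product in the multiplicative case.
  Multivariate arguments are reduced in this way to one variable at a time.\<close>

lemma polyfun_expand:
  assumes "H \<in> polyfun (insert k J)"
  shows "\<exists>F N. (\<forall>i. F i \<in> polyfun J) \<and> (\<forall>v. H v = (\<Sum>i\<le>N. F i v * v k ^ i))"
proof -
  \<comment> \<open>The added clause that coefficients beyond \<open>N\<close> vanish lets two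
    expansions be padded to a common length and multiplied with
    \<open>polynomial_product\<close>.\<close>
  from assms have "\<exists>F N. (\<forall>i. F i \<in> polyfun J) \<and> (\<forall>i>N. \<forall>v. F i v = 0) \<and>
      (\<forall>v. H v = (\<Sum>i\<le>N. F i v * v k ^ i))"
  proof induction
    case (const c)
    show ?case
      by (rule exI[of _ "\<lambda>i v. if i = 0 then c else 0"], rule exI[of _ 0]) (auto intro: polyfun.const)
  next
    case (var j)
    show ?case
    proof (cases "j = k")
      case True
      then show ?thesis
        by (intro exI[of _ "\<lambda>i v. if i = 1 then 1 else 0"] exI[of _ 1]) (auto intro: polyfun.const)
    next
      case False
      with var have "(\<lambda>v. v j) \<in> polyfun J" by (auto intro: polyfun.var)
      then show ?thesis
        by (intro exI[of _ "\<lambda>i. if i = 0 then \<lambda>v. v j else (\<lambda>v. 0)"] exI[of _ 0])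
            (auto intro: polyfun.const)
    qed
  next
    case (add G H)
    obtain F N where G: "\<forall>i. F i \<in> polyfun J" "\<forall>i>N. \<forall>v. F i v = 0"
      "\<forall>v. G v = (\<Sum>i\<le>N. F i v * v k ^ i)" using add.IH(1) by (elim exE conjE)
    obtain F' N' where H: "\<forall>i. F' i \<in> polyfun J" "\<forall>i>N'. \<forall>v. F' i v = 0"
      "\<forall>v. H v = (\<Sum>i\<le>N'. F' i v * v k ^ i)" using add.IH(2) by (elim exE conjE)
    note * = G[rule_format] H[rule_format]
    have "G v + H v = (\<Sum>i\<le>max N N'. (F i v + F' i v) * v k ^ i)" for v
    proof -
      have "G v = (\<Sum>i\<le>max N N'. F i v * v k ^ i)" "H v = (\<Sum>i\<le>max N N'. F' i v * v k ^ i)"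
        unfolding *(3,6) by (auto intro!: sum.mono_neutral_left simp flip: not_less simp: *(2,5))
      then show ?thesis by (simp add: sum.distrib algebra_simps)
    qed
    moreover have "\<forall>i>max N N'. \<forall>v. F i v + F' i v = 0"
      using *(2,5) by simp
    moreover have "\<forall>i. (\<lambda>v. F i v + F' i v) \<in> polyfun J"
      using *(1,4) by (blast intro: polyfun.add)
    ultimately show ?case
      by (intro exI[of _ "\<lambda>i v. F i v + F' i v"] exI[of _ "max N N'"]) blast
  next
    case (mult G H)
    obtain F N where G: "\<forall>i. F i \<in> polyfun J" "\<forall>i>N. \<forall>v. F i v = 0"
      "\<forall>v. G v = (\<Sum>i\<le>N. F i v * v k ^ i)" using mult.IH(1) by (elim exE conjE)
    obtain F' N' where H: "\<forall>i. F' i \<in> polyfun J" "\<forall>i>N'. \<forall>v. F' i v = 0"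
      "\<forall>v. H v = (\<Sum>i\<le>N'. F' i v * v k ^ i)" using mult.IH(2) by (elim exE conjE)
    note * = G[rule_format] H[rule_format]
    let ?F = "\<lambda>r v. \<Sum>i\<le>r. F i v * F' (r - i) v"
    have "G v * H v = (\<Sum>r\<le>N + N'. ?F r v * v k ^ r)" for v
      unfolding *(3,6) by (rule polynomial_product) (simp_all add: *)
    moreover have "?F r v = 0" if "r > N + N'" for r v
    proof (intro sum.neutral ballI)
      fix i assume "i \<in> {..r}"
      with that have "i > N \<or> r - i > N'" by auto
      then show "F i v * F' (r - i) v = 0" using *(2,5) by auto
    qed
    moreover have "\<forall>r. ?F r \<in> polyfun J"
      using *(1,4) by (auto intro!: polyfun_sum polyfun.mult)
    ultimately show ?case
      by (intro exI[of _ ?F] exI[of _ "N + N'"]) blast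
  qed
  then show ?thesis by blast
qed

section \<open>Lifting points of the closure along an integral coordinate\<close>

text \<open>Points are total functions here, so that coordinates can be adjoined one at a time; only the
  coordinates in \<open>J\<close> matter for membership.\<close>

definition zclosure :: "nat set \<Rightarrow> (nat \<Rightarrow> complex) set \<Rightarrow> (nat \<Rightarrow> complex) set" where
  "zclosure J S = {b. \<forall>F\<in>polyfun J. (\<forall>s\<in>S. F s = 0) \<longrightarrow> F b = 0}"

lemma zclosureD: "b \<in> zclosure J S \<Longrightarrow> F \<in> polyfun J \<Longrightarrow> (\<And>s. s \<in> S \<Longrightarrow> F s = 0) \<Longrightarrow> F b = 0"
  by (auto simp: zclosure_def)

text \<open>A nonzero element of least degree divides all of \<open>I\<close>; if it were not
  constant, its complex root would be common to \<open>I\<close>. This is the Nullstellensatz in one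
  variable.\<close>

lemma ideal_without_common_root:
  fixes I :: "complex poly set"
  assumes add: "\<And>P Q. P \<in> I \<Longrightarrow> Q \<in> I \<Longrightarrow> P + Q \<in> I"
    and mult: "\<And>P Q. P \<in> I \<Longrightarrow> Q * P \<in> I"
    and noroot: "\<And>y. \<exists>P\<in>I. poly P y \<noteq> 0"
  shows "1 \<in> I"
proof -
  from noroot[of 0] have "\<exists>P. P \<in> I \<and> P \<noteq> 0" by auto
  then obtain P where P: "P \<in> I" "P \<noteq> 0" and min: "\<And>Q. Q \<in> I \<Longrightarrow> Q \<noteq> 0 \<Longrightarrow> degree P \<le> degree Q"
    using ex_has_least_nat[of "\<lambda>P. P \<in> I \<and> P \<noteq> 0" _ degree] by metis
  have dvd: "P dvd Q" if "Q \<in> I" for Q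
  proof -
    have "Q mod P = Q + (- (Q div P)) * P" by (simp flip: minus_div_mult_eq_mod)
    then have "Q mod P \<in> I" using add mult that P(1) by metis
    then have "Q mod P = 0"
      using min P(2) degree_mod_less' by (metis not_less)
    then show ?thesis by auto
  qed
  have "degree P = 0"
  proof (rule ccontr)
    assume "degree P \<noteq> 0"
    then obtain z where "poly P z = 0"
      using fundamental_theorem_of_algebra_alt[of P] by (metis degree_pCons_0)
    then have "poly Q z = 0" if "Q \<in> I" for Q
      using dvd[OF that] by (auto elim!: dvdE)
    with noroot[of z] show False by blast
  qed
  then obtain c where "P = [:c:]" "c \<noteq> 0" using P(2) by (metis degree_eq_zeroE pCons_0_0)
  with mult[OF P(1), of "[:1 / c:]"] show ?thesis by (simp add: one_pCons)
qed

text \<open>By the Leibniz formula; it keeps the Sylvester determinant used below inside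
  \<open>polyfun J\<close>.\<close>

lemma det_polyfun:
  assumes "\<And>i j. i < n \<Longrightarrow> j < n \<Longrightarrow> A i j \<in> polyfun J"
  shows "(\<lambda>v. det (mat n n (\<lambda>(i, j). A i j v))) \<in> polyfun J"
proof -
  have "(\<lambda>v. \<Sum>p | p permutes {0..<n}. signof p * (\<Prod>i = 0..<n. A i (p i) v)) \<in> polyfun J"
    using assms
    by (intro polyfun_sum polyfun.mult polyfun.const polyfun_prod) (auto simp: permutes_in_image)
  also have "(\<lambda>v. \<Sum>p | p permutes {0..<n}. signof p * (\<Prod>i = 0..<n. A i (p i) v)) =
      (\<lambda>v. det (mat n n (\<lambda>(i, j). A i j v)))"
    by (rule ext, subst det_def'[of _ n])
      (auto simp: permutes_in_image intro!: sum.cong prod.cong)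
  finally show ?thesis .
qed

text \<open>If no value of the new coordinate works, the polynomials vanishing on \<open>S\<close> and restricted to the
  line over \<open>b\<close> generate the unit ideal, so one of them, \<open>H\<close>, restricts to 1. The Sylvester
  determinant of \<open>H\<close> and the integral equation then vanishes on \<open>S\<close> but not at \<open>b\<close>.\<close>

lemma zclosure_lift:
  assumes b: "b \<in> zclosure J S" and \<kappa>: "\<kappa> \<notin> J"
    and c: "\<And>i. c i \<in> polyfun J"
    and root: "\<And>s. s \<in> S \<Longrightarrow> (\<Sum>i\<le>k. c i s * s \<kappa> ^ i) = 0"
    and lead: "c k b \<noteq> 0"
  shows "\<exists>y. b(\<kappa> := y) \<in> zclosure (insert \<kappa> J) S"
proof (rule ccontr)
  assume contra: "\<not> ?thesis"
  have indep: "F (b(\<kappa> := y)) = F b" if "F \<in> polyfun J" for F y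
    using that by (rule polyfun_cong) (use \<kappa> in auto)
  \<comment> \<open>Restrictions to the line of all \<open>b(\<kappa> := y)\<close>, as polynomials
    in the parameter \<open>y\<close>.\<close>
  define I where "I = {P :: complex poly. \<exists>H\<in>polyfun (insert \<kappa> J). (\<forall>s\<in>S. H s = 0) \<and>
      (\<forall>y. H (b(\<kappa> := y)) = poly P y)}"
  have "1 \<in> I"
  proof (rule ideal_without_common_root)
    fix P Q assume "P \<in> I" "Q \<in> I"
    then obtain F G where "F \<in> polyfun (insert \<kappa> J)" "G \<in> polyfun (insert \<kappa> J)"
      "\<And>s. s \<in> S \<Longrightarrow> F s = 0" "\<And>s. s \<in> S \<Longrightarrow> G s = 0"
      "\<And>y. F (b(\<kappa> := y)) = poly P y" "\<And>y. G (b(\<kappa> := y)) = poly Q y"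
      unfolding I_def by blast
    then show "P + Q \<in> I"
      unfolding I_def by (intro CollectI bexI[of _ "\<lambda>v. F v + G v"]) (auto intro: polyfun.add)
  next
    fix P Q assume "P \<in> I"
    then obtain F where F: "F \<in> polyfun (insert \<kappa> J)" "\<And>s. s \<in> S \<Longrightarrow> F s = 0"
      "\<And>y. F (b(\<kappa> := y)) = poly P y"
      unfolding I_def by blast
    have "(\<lambda>v. poly Q (v \<kappa>)) \<in> polyfun (insert \<kappa> J)"
      unfolding poly_altdef by (intro polyfun_sum polyfun.mult polyfun.const polyfun_power polyfun.var) auto
    with F show "Q * P \<in> I"
      unfolding I_def by (intro CollectI bexI[of _ "\<lambda>v. poly Q (v \<kappa>) * F v"]) (auto intro: polyfun.mult)
  next
    fix y
    from contra have "b(\<kappa> := y) \<notin> zclosure (insert \<kappa> J) S" by blast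
    then obtain H where H: "H \<in> polyfun (insert \<kappa> J)" "\<And>s. s \<in> S \<Longrightarrow> H s = 0" "H (b(\<kappa> := y)) \<noteq> 0"
      by (auto simp: zclosure_def)
    from polyfun_expand[OF H(1)]
    obtain F N where F: "\<And>i. F i \<in> polyfun J" "\<And>v. H v = (\<Sum>i\<le>N. F i v * v \<kappa> ^ i)"
      by blast
    have "H (b(\<kappa> := z)) = poly (\<Sum>i\<le>N. monom (F i b) i) z" for z
      by (simp add: F indep poly_sum poly_monom)
    with H show "\<exists>P\<in>I. poly P y \<noteq> 0"
      unfolding I_def by (intro bexI[of _ "\<Sum>i\<le>N. monom (F i b) i"]) auto
  qed
  then obtain H where H: "H \<in> polyfun (insert \<kappa> J)" "\<And>s. s \<in> S \<Longrightarrow> H s = 0"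
    "\<And>y. H (b(\<kappa> := y)) = 1"
    unfolding I_def by auto
  from polyfun_expand[OF H(1)]
  obtain F N where F: "\<And>i. F i \<in> polyfun J" "\<And>v. H v = (\<Sum>i\<le>N. F i v * v \<kappa> ^ i)"
    by blast
  have "poly (\<Sum>i\<le>N. monom (F i b) i) y = poly 1 y" for y
    using H(3)[of y] by (simp add: F indep poly_sum poly_monom)
  then have "(\<Sum>i\<le>N. monom (F i b) i) = 1"
    using poly_eq_poly_eq_iff by blast
  then have one: "coeff (\<Sum>i\<le>N. monom (F i b) i) r = coeff 1 r" for r by simp
  \<comment> \<open>Over \<open>b\<close> the function \<open>H\<close> is the constant 1 in
    coordinate \<open>\<kappa>\<close>, which determines its coefficients there.\<close>
  have Fb: "F r b = (if r = 0 then 1 else 0)" if "r \<le> N" for r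
    using one[of r] that by (simp add: coeff_sum coeff_monom)
  \<comment> \<open>Sylvester matrix with the rows of \<open>H\<close> first, which makes it lower triangular at \<open>b\<close>.\<close>
  define A where "A = (\<lambda>r j. if r < k then (if r \<le> j \<and> j \<le> r + N then F (j - r) else (\<lambda>v. 0))
    else (if r - k \<le> j \<and> j \<le> r then c (j - (r - k)) else (\<lambda>v. 0)))"
  define D where "D = (\<lambda>v. det (mat (k + N) (k + N) (\<lambda>(i, j). A i j v)))"
  \<comment> \<open>A shifted coefficient row paired with the powers of \<open>y\<close> gives
    \<open>y ^ r\<close> times the value of the polynomial; both blocks of rows are
    instances.\<close>
  have shift: "(\<Sum>j<k + N. (if r \<le> j \<and> j \<le> r + M then f (j - r) else 0) * y ^ j) =
      y ^ r * (\<Sum>i\<le>M. f i * y ^ i)" if "r + M < k + N" for r M f and y :: complex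
  proof -
    have "(\<Sum>j<k + N. (if r \<le> j \<and> j \<le> r + M then f (j - r) else 0) * y ^ j) =
        (\<Sum>j\<in>{0 + r..M + r}. f (j - r) * y ^ j)"
      by (rule sum.mono_neutral_cong_right) (use that in auto)
    also have "\<dots> = (\<Sum>i\<le>M. f i * y ^ (i + r))"
      by (subst sum.shift_bounds_cl_nat_ivl) (simp add: atLeast0AtMost)
    finally show ?thesis by (simp add: sum_distrib_left power_add mult_ac)
  qed
  have "D \<in> polyfun J"
    unfolding D_def by (rule det_polyfun) (auto simp: A_def F c polyfun.const)
  moreover have "D s = 0" if s: "s \<in> S" for s
  proof (cases "k + N = 0")
    \<comment> \<open>The empty determinant is 1, so this case has to be contradictory:
      \<open>H\<close> is then \<open>F 0\<close>, whose vanishing on \<open>S\<close> carries over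
      to \<open>b\<close>, against \<open>Fb\<close>.\<close>
    case True
    then have "F 0 s = 0" if "s \<in> S" for s
      using H(2) F(2) that by auto
    with b F(1) have "F 0 b = 0" by (rule zclosureD)
    then show ?thesis using Fb by simp
  next
    case False
    let ?A = "mat (k + N) (k + N) (\<lambda>(i, j). A i j s)"
    \<comment> \<open>The common root \<open>s \<kappa>\<close> of the two polynomials yields a
      kernel vector, nonzero because its entry 0 is 1.\<close>
    define w where "w = vec (k + N) (\<lambda>j. s \<kappa> ^ j)"
    have "row ?A r \<bullet> w = 0" if r: "r < k + N" for r
    proof -
      have row: "row ?A r \<bullet> w = (\<Sum>j<k + N. A r j s * s \<kappa> ^ j)"
        using r by (simp add: scalar_prod_def w_def atLeast0LessThan)
      show ?thesis
      proof (cases "r < k")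
        case True
        have "row ?A r \<bullet> w =
            (\<Sum>j<k + N. (if r \<le> j \<and> j \<le> r + N then F (j - r) s else 0) * s \<kappa> ^ j)"
          unfolding row using True by (intro sum.cong) (auto simp: A_def)
        also have "\<dots> = 0" using True H(2)[OF s] by (subst shift) (auto simp: F(2))
        finally show ?thesis .
      next
        case False
        have "row ?A r \<bullet> w =
            (\<Sum>j<k + N. (if r - k \<le> j \<and> j \<le> r - k + k then c (j - (r - k)) s else 0) * s \<kappa> ^ j)"
          unfolding row using False by (intro sum.cong) (auto simp: A_def)
        also have "\<dots> = 0" using False r root[OF s] by (subst shift) auto
        finally show ?thesis .
      qed
    qed
    then have "?A *\<^sub>v w = 0\<^sub>v (k + N)"
      by (intro eq_vecI) auto
    moreover have "w $ 0 = 1" using False by (simp add: w_def)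
    then have "w \<noteq> 0\<^sub>v (k + N)" using False by auto
    moreover have "w \<in> carrier_vec (k + N)" by (simp add: w_def)
    ultimately show ?thesis
      unfolding D_def by (subst det_0_iff_vec_prod_zero_field[of _ "k + N"]) auto
  qed
  ultimately have "D b = 0" by (rule zclosureD[OF b])
  \<comment> \<open>At \<open>b\<close> the diagonal consists of \<open>F 0 b = 1\<close> in the
    first \<open>k\<close> rows and of \<open>c k b\<close> in the other \<open>N\<close>
    rows.\<close>
  moreover have "D b \<noteq> 0"
  proof -
    let ?A = "mat (k + N) (k + N) (\<lambda>(i, j). A i j b)"
    have "det ?A = prod_list (diag_mat ?A)"
      by (rule det_lower_triangular[of "k + N"]) (auto simp: A_def Fb)
    also have "\<dots> \<noteq> 0"
      using lead Fb[of 0] by (auto simp: prod_list_zero_iff diag_mat_def A_def split: if_splits)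
    finally show ?thesis by (simp add: D_def)
  qed
  ultimately show False by simp
qed

section \<open>Algebraic relations over the radical tower\<close>

text \<open>Fraction-free Gaussian elimination: one equation and one pivot unknown are removed at a
  time by cross-multiplication, so the solution stays in the domain. It is applied over
  \<open>complex poly\<close>.\<close>

lemma linear_dependence:
  fixes f :: "'j \<Rightarrow> 'i \<Rightarrow> 'a::idom"
  assumes "finite I" "finite J" "card I < card J"
  shows "\<exists>c. (\<exists>j\<in>J. c j \<noteq> 0) \<and> (\<forall>i\<in>I. (\<Sum>j\<in>J. c j * f j i) = 0)"
  using assms
proof (induction I arbitrary: J f rule: finite_induct)
  case empty
  then have "J \<noteq> {}" by auto
  then show ?case by (intro exI[of _ "\<lambda>_. 1"]) auto
next
  case (insert i I)
  show ?case
  proof (cases "\<forall>j\<in>J. f j i = 0")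
    case True
    have "card I < card J" using insert by simp
    then obtain c where "\<exists>j\<in>J. c j \<noteq> 0" "\<forall>i\<in>I. (\<Sum>j\<in>J. c j * f j i) = 0"
      using insert.IH[of J f] insert.prems by auto
    with True show ?thesis by (intro exI[of _ c]) auto
  next
    case False
    then obtain z where z: "z \<in> J" "f z i \<noteq> 0" by auto
    have "card I < card (J - {z})" using insert z by simp
    then obtain c where c: "\<exists>j\<in>J - {z}. c j \<noteq> 0"
      "\<forall>i'\<in>I. (\<Sum>j\<in>J - {z}. c j * (f z i * f j i' - f j i * f z i')) = 0"
      using insert.IH[of "J - {z}" "\<lambda>j i'. f z i * f j i' - f j i * f z i'"] insert.prems by auto
    \<comment> \<open>\<open>c' z\<close> is chosen to solve equation \<open>i\<close>; scaling the
      other unknowns by the pivot \<open>f z i\<close> makes this possible without division.\<close>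
    define c' where "c' = (\<lambda>j. if j = z then - (\<Sum>j\<in>J - {z}. c j * f j i) else c j * f z i)"
    have split: "(\<Sum>j\<in>J. c' j * f j i') = (\<Sum>j\<in>J - {z}. c j * (f z i * f j i' - f j i * f z i'))" for i'
    proof -
      have "(\<Sum>j\<in>J. c' j * f j i') = c' z * f z i' + (\<Sum>j\<in>J - {z}. c' j * f j i')"
        using z insert.prems by (simp add: sum.remove)
      also have "(\<Sum>j\<in>J - {z}. c' j * f j i') = (\<Sum>j\<in>J - {z}. c j * f z i * f j i')"
        by (rule sum.cong) (auto simp: c'_def)
      also have "c' z * f z i' = (\<Sum>j\<in>J - {z}. - (c j * f j i * f z i'))"
        by (simp add: c'_def sum_distrib_right sum_negf)
      finally show ?thesis by (simp flip: sum.distrib add: algebra_simps)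
    qed
    have "(\<Sum>j\<in>J. c' j * f j i') = 0" if "i' \<in> insert i I" for i'
      unfolding split using that c(2) by (auto simp: mult.commute)
    moreover have "\<exists>j\<in>J. c' j \<noteq> 0" using c(1) z(2) by (auto simp: c'_def)
    ultimately show ?thesis by blast
  qed
qed

text \<open>Reduction modulo the monic relation \<open>v k ^ e = G v\<close>, valid on
  \<open>V\<close>. The representable functions are closed under sums, under multiplication by
  \<open>polyfun J\<close> and by coordinate \<open>k\<close>, hence contain every expansion from
  \<open>polyfun_expand\<close>.\<close>

lemma polyfun_reduce_degree:
  assumes e: "e > 0" and G: "G \<in> polyfun J" and V: "\<And>v. v \<in> V \<Longrightarrow> v k ^ e = G v"
    and H: "H \<in> polyfun (insert k J)"
  shows "\<exists>F. (\<forall>i. F i \<in> polyfun J) \<and> (\<forall>v\<in>V. H v = (\<Sum>i<e. F i v * v k ^ i))"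
proof -
  define T where "T = (\<lambda>H. \<exists>F. (\<forall>i. F i \<in> polyfun J) \<and> (\<forall>v\<in>V. H v = (\<Sum>i<e. F i v * v k ^ i)))"
  have T_add: "T (\<lambda>v. H v + H' v)" if "T H" "T H'" for H H'
  proof -
    from that obtain F F' where "\<forall>i. F i \<in> polyfun J" "\<forall>v\<in>V. H v = (\<Sum>i<e. F i v * v k ^ i)"
      "\<forall>i. F' i \<in> polyfun J" "\<forall>v\<in>V. H' v = (\<Sum>i<e. F' i v * v k ^ i)"
      unfolding T_def by blast
    then show ?thesis
      unfolding T_def by (intro exI[of _ "\<lambda>i v. F i v + F' i v"])
        (auto intro: polyfun.add simp: sum.distrib algebra_simps)
  qed
  have T_mult: "T (\<lambda>v. C v * H v)" if "T H" "C \<in> polyfun J" for C H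
  proof -
    from that obtain F where "\<forall>i. F i \<in> polyfun J" "\<forall>v\<in>V. H v = (\<Sum>i<e. F i v * v k ^ i)"
      unfolding T_def by blast
    with that(2) show ?thesis
      unfolding T_def by (intro exI[of _ "\<lambda>i v. C v * F i v"])
        (auto intro: polyfun.mult simp: sum_distrib_left mult.assoc)
  qed
  have T_shift: "T (\<lambda>v. v k * H v)" if "T H" for H
  proof -
    from that obtain F where F: "\<forall>i. F i \<in> polyfun J" "\<forall>v\<in>V. H v = (\<Sum>i<e. F i v * v k ^ i)"
      unfolding T_def by blast
    obtain d where d: "e = Suc d" using e by (cases e) auto
    \<comment> \<open>Every coefficient moves up one place, and the top one returns at place 0
      multiplied by \<open>G\<close>.\<close>
    let ?F = "\<lambda>i. if i = 0 then \<lambda>v. F d v * G v else F (i - 1)"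
    have "v k * H v = (\<Sum>i<e. ?F i v * v k ^ i)" if "v \<in> V" for v
    proof -
      have "v k * H v = (\<Sum>i<Suc d. F i v * v k ^ Suc i)"
        using F(2) that by (simp add: d sum_distrib_left distrib_left mult_ac)
      also have "\<dots> = F d v * G v + (\<Sum>i<d. F i v * v k ^ Suc i)"
        using V[OF that] by (simp add: d)
      also have "\<dots> = (\<Sum>i<e. ?F i v * v k ^ i)"
        unfolding d by (subst sum.lessThan_Suc_shift) simp
      finally show ?thesis .
    qed
    moreover have "\<forall>i. ?F i \<in> polyfun J" using F(1) G by (auto intro: polyfun.mult)
    ultimately show ?thesis unfolding T_def by (intro exI[of _ ?F]) blast
  qed
  have "T (\<lambda>v. v k ^ i)" for i
  proof (induction i)
    case 0
    have "(\<Sum>i<e. (if i = 0 then 1 else 0) * x ^ i) = 1" for x :: complex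
      using e by (simp add: if_distrib[of "\<lambda>y. y * _"] cong: if_cong)
    then show ?case
      unfolding T_def by (intro exI[of _ "\<lambda>i v. if i = 0 then 1 else 0"]) (auto intro: polyfun.const)
  qed (use T_shift in simp)
  then have T_monom: "T (\<lambda>v. C v * v k ^ i)" if "C \<in> polyfun J" for C i
    using that by (rule T_mult)
  have T_sum: "T (\<lambda>v. \<Sum>i\<le>N. F i v * v k ^ i)" if "\<And>i. F i \<in> polyfun J" for F and N :: nat
  proof (induction N)
    case 0
    then show ?case using T_monom[OF that, of 0 0] by simp
  next
    case (Suc N)
    then show ?case using T_add[OF Suc.IH T_monom[OF that, of "Suc N" "Suc N"]] by simp
  qed
  from polyfun_expand[OF H] obtain F N where F: "\<forall>i. F i \<in> polyfun J"
    "\<forall>v. H v = (\<Sum>i\<le>N. F i v * v k ^ i)" by blast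
  then have "H = (\<lambda>v. \<Sum>i\<le>N. F i v * v k ^ i)" by auto
  with T_sum F(1) have "T H" by auto
  then show ?thesis unfolding T_def .
qed

text \<open>Over the polynomials in coordinate 0, the functions on \<open>V\<close> are generated by
  the monomials whose exponent at each \<open>i\<close> is below \<open>e i\<close>. The lists in
  \<open>I\<close> are these exponent vectors, highest coordinate first. Only generation is claimed,
  not independence.\<close>

lemma polyfun_tower_span:
  fixes V :: "(nat \<Rightarrow> complex) set"
  assumes "\<And>i. i \<in> {1..m} \<Longrightarrow> e i > 0"
    and "\<And>i. i \<in> {1..m} \<Longrightarrow> G i \<in> polyfun {..<i}"
    and "\<And>i v. i \<in> {1..m} \<Longrightarrow> v \<in> V \<Longrightarrow> v i ^ e i = G i v"
  shows "\<exists>(I :: nat list set) b. finite I \<and> card I = (\<Prod>i = 1..m. e i) \<and>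
    (\<forall>H\<in>polyfun {..m}. \<exists>r. \<forall>v\<in>V. H v = (\<Sum>\<alpha>\<in>I. poly (r \<alpha>) (v 0) * b \<alpha> v))"
  using assms
proof (induction m)
  case 0
  have expand: "\<exists>r. \<forall>v. H v = poly r (v 0)" if H: "H \<in> polyfun {..0}" for H
  proof -
    have "H \<in> polyfun (insert 0 {})" using H by simp
    from polyfun_expand[OF this] obtain F N where F: "\<And>i. F i \<in> polyfun {}"
      "\<And>v. H v = (\<Sum>i\<le>N. F i v * v 0 ^ i)" by blast
    \<comment> \<open>A function in \<open>polyfun {}\<close> reads no coordinate, so
      \<open>H\<close> is a univariate polynomial in coordinate 0.\<close>
    have const: "F i v = F i (\<lambda>_. 0)" for i v
      using F(1)[of i] by (rule polyfun_cong) auto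
    have "H v = poly (\<Sum>i\<le>N. monom (F i (\<lambda>_. 0)) i) (v 0)" for v
      unfolding F(2) poly_sum poly_monom by (intro sum.cong refl arg_cong2[where f = "(*)"] const)
    then show ?thesis by blast
  qed
  have "\<exists>r. \<forall>v\<in>V. H v = (\<Sum>\<alpha>\<in>{[]}. poly (r \<alpha>) (v 0) * 1)" if "H \<in> polyfun {..0}" for H
  proof -
    from expand[OF that] obtain r where "\<forall>v. H v = poly r (v 0)" ..
    then show ?thesis by (intro exI[of _ "\<lambda>_. r"]) simp
  qed
  then show ?case by (intro exI[of _ "{[]}"] exI[of _ "\<lambda>_ _. 1"]) auto
next
  case (Suc m)
  have "\<exists>(I :: nat list set) b. finite I \<and> card I = (\<Prod>i = 1..m. e i) \<and>
    (\<forall>H\<in>polyfun {..m}. \<exists>r. \<forall>v\<in>V. H v = (\<Sum>\<alpha>\<in>I. poly (r \<alpha>) (v 0) * b \<alpha> v))"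
    by (rule Suc.IH) (use Suc.prems in auto)
  then obtain I :: "nat list set" and b where I: "finite I" "card I = (\<Prod>i = 1..m. e i)"
    and span: "\<And>H. H \<in> polyfun {..m} \<Longrightarrow> \<exists>r. \<forall>v\<in>V. H v = (\<Sum>\<alpha>\<in>I. poly (r \<alpha>) (v 0) * b \<alpha> v)"
    by blast
  define I' where "I' = (\<lambda>(i, \<alpha>). i # \<alpha>) ` ({..<e (Suc m)} \<times> I)"
  define b' where "b' = (\<lambda>\<alpha> v. v (Suc m) ^ hd \<alpha> * b (tl \<alpha>) v)"
  have inj: "inj_on (\<lambda>(i, \<alpha>). i # \<alpha>) ({..<e (Suc m)} \<times> I)" by (auto simp: inj_on_def)
  have "finite I'" using I by (simp add: I'_def)
  moreover have "card I' = (\<Prod>i = 1..Suc m. e i)"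
    using I by (simp add: I'_def card_image[OF inj] card_cartesian_product)
  moreover have "\<exists>r. \<forall>v\<in>V. H v = (\<Sum>\<alpha>\<in>I'. poly (r \<alpha>) (v 0) * b' \<alpha> v)" if H: "H \<in> polyfun {..Suc m}" for H
  proof -
    have "\<exists>F. (\<forall>i. F i \<in> polyfun {..m}) \<and> (\<forall>v\<in>V. H v = (\<Sum>i<e (Suc m). F i v * v (Suc m) ^ i))"
      using Suc.prems(1)[of "Suc m"] Suc.prems(2)[of "Suc m"] Suc.prems(3)[of "Suc m"] H
      by (intro polyfun_reduce_degree[of "e (Suc m)" "G (Suc m)"])
        (auto simp: lessThan_Suc_atMost atMost_Suc)
    then obtain F where F: "\<And>i. F i \<in> polyfun {..m}"
      "\<And>v. v \<in> V \<Longrightarrow> H v = (\<Sum>i<e (Suc m). F i v * v (Suc m) ^ i)" by blast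
    from span[OF F(1)] obtain r
      where r: "\<And>i v. v \<in> V \<Longrightarrow> F i v = (\<Sum>\<alpha>\<in>I. poly (r i \<alpha>) (v 0) * b \<alpha> v)" by metis
    have "H v = (\<Sum>\<alpha>\<in>I'. poly (r (hd \<alpha>) (tl \<alpha>)) (v 0) * b' \<alpha> v)" if "v \<in> V" for v
    proof -
      have "H v = (\<Sum>i<e (Suc m). \<Sum>\<alpha>\<in>I. poly (r i \<alpha>) (v 0) * b' (i # \<alpha>) v)"
        by (simp add: F(2)[OF that] r[OF that] b'_def sum_distrib_right mult.assoc)
          (simp add: mult.commute)
      also have "\<dots> = (\<Sum>(i, \<alpha>)\<in>{..<e (Suc m)} \<times> I. poly (r i \<alpha>) (v 0) * b' (i # \<alpha>) v)"
        by (rule sum.cartesian_product)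
      also have "\<dots> = (\<Sum>\<alpha>\<in>I'. poly (r (hd \<alpha>) (tl \<alpha>)) (v 0) * b' \<alpha> v)"
        unfolding I'_def sum.reindex[OF inj] by (intro sum.cong) auto
      finally show ?thesis .
    qed
    then show ?thesis by (intro exI[of _ "\<lambda>\<alpha>. r (hd \<alpha>) (tl \<alpha>)"] ballI)
  qed
  ultimately show ?case by (intro exI[of _ I'] exI[of _ b'] conjI ballI)
qed

text \<open>The \<open>d + 1\<close> products \<open>A ^ j * B ^ (d - j)\<close> lie in a module
  with \<open>d\<close> generators, so they are dependent over \<open>complex poly\<close>. Where
  \<open>B\<close> does not vanish, this is a relation of degree at most \<open>d\<close> for
  \<open>A / B\<close>; the homogeneous form avoids the division.\<close>

lemma tower_algebraic_relation:
  fixes V :: "(nat \<Rightarrow> complex) set"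
  assumes "\<And>i. i \<in> {1..m} \<Longrightarrow> e i > 0"
    and "\<And>i. i \<in> {1..m} \<Longrightarrow> G i \<in> polyfun {..<i}"
    and "\<And>i v. i \<in> {1..m} \<Longrightarrow> v \<in> V \<Longrightarrow> v i ^ e i = G i v"
    and A: "A \<in> polyfun {..m}" and B: "B \<in> polyfun {..m}"
  defines "d \<equiv> \<Prod>i = 1..m. e i"
  shows "\<exists>c. (\<exists>j\<le>d. c j \<noteq> 0) \<and> (\<forall>v\<in>V. (\<Sum>j\<le>d. poly (c j) (v 0) * (A v ^ j * B v ^ (d - j))) = 0)"
proof -
  obtain I :: "nat list set" and b where I: "finite I" "card I = d"
    and span: "\<And>H. H \<in> polyfun {..m} \<Longrightarrow> \<exists>r. \<forall>v\<in>V. H v = (\<Sum>\<alpha>\<in>I. poly (r \<alpha>) (v 0) * b \<alpha> v)"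
    using polyfun_tower_span[of m e G V, OF assms(1-3)] unfolding d_def by blast
  have "(\<lambda>v. A v ^ j * B v ^ (d - j)) \<in> polyfun {..m}" for j
    by (intro polyfun.mult polyfun_power A B)
  from span[OF this] obtain r where r: "\<And>j v. v \<in> V \<Longrightarrow>
      A v ^ j * B v ^ (d - j) = (\<Sum>\<alpha>\<in>I. poly (r j \<alpha>) (v 0) * b \<alpha> v)" by metis
  from I linear_dependence[of I "{..d}" r] obtain c
    where c: "\<exists>j\<le>d. c j \<noteq> 0" "\<And>\<alpha>. \<alpha> \<in> I \<Longrightarrow> (\<Sum>j\<le>d. c j * r j \<alpha>) = 0" by auto
  have "(\<Sum>j\<le>d. poly (c j) (v 0) * (A v ^ j * B v ^ (d - j))) = 0" if v: "v \<in> V" for v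
  proof -
    have "(\<Sum>j\<le>d. poly (c j) (v 0) * (A v ^ j * B v ^ (d - j))) =
        (\<Sum>j\<le>d. \<Sum>\<alpha>\<in>I. poly (c j * r j \<alpha>) (v 0) * b \<alpha> v)"
      by (simp add: r[OF v] sum_distrib_left mult.assoc)
    also have "\<dots> = (\<Sum>\<alpha>\<in>I. poly (\<Sum>j\<le>d. c j * r j \<alpha>) (v 0) * b \<alpha> v)"
      by (subst sum.swap) (simp add: poly_sum sum_distrib_right)
    also have "\<dots> = 0" using c(2) by simp
    finally show ?thesis .
  qed
  then show ?thesis by (intro exI[of _ c] conjI ballI c(1))
qed

text \<open>Lying-over, one radical at a time: coordinate \<open>i\<close> is a root of a monic
  polynomial whose coefficients use only coordinates lifted earlier, so \<open>zclosure_lift\<close>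
  always applies.\<close>

lemma tower_lift:
  assumes e: "\<And>i. i \<in> {1..m} \<Longrightarrow> e i > 0"
    and G: "\<And>i. i \<in> {1..m} \<Longrightarrow> G i \<in> polyfun {..<i}"
    and root: "\<And>i s. i \<in> {1..m} \<Longrightarrow> s \<in> S \<Longrightarrow> s i ^ e i = G i s"
    and K: "K \<inter> {..m} = {}"
    and a: "a \<in> zclosure (insert 0 K) S"
  shows "\<exists>a'\<in>zclosure ({..m} \<union> K) S. \<forall>i\<in>K. a' i = a i"
proof -
  have "j \<le> m \<Longrightarrow> \<exists>a'\<in>zclosure ({..j} \<union> K) S. \<forall>i\<in>K. a' i = a i" for j
  proof (induction j)
    case 0
    then show ?case using a by (auto intro!: bexI[of _ a])
  next
    case (Suc j)
    then obtain a' where a': "a' \<in> zclosure ({..j} \<union> K) S" "\<forall>i\<in>K. a' i = a i" by auto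
    have j: "Suc j \<in> {1..m}" using Suc.prems by auto
    \<comment> \<open>The coefficients of \<open>X ^ e (Suc j) - G (Suc j)\<close>; positivity of
      \<open>e (Suc j)\<close> keeps the two nonzero positions apart.\<close>
    define c where "c = (\<lambda>i. if i = e (Suc j) then (\<lambda>v. 1) else if i = 0 then (\<lambda>v. - G (Suc j) v)
      else (\<lambda>v. 0 :: complex))"
    have "\<exists>y. a'(Suc j := y) \<in> zclosure (insert (Suc j) ({..j} \<union> K)) S"
    proof (rule zclosure_lift[OF a'(1)])
      show "Suc j \<notin> {..j} \<union> K" using K Suc.prems by auto
      have "G (Suc j) \<in> polyfun ({..j} \<union> K)" using G[OF j] by (rule polyfun_mono) auto
      then show "c i \<in> polyfun ({..j} \<union> K)" for i
        by (auto simp: c_def intro: polyfun.const polyfun_uminus)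
      show "c (e (Suc j)) a' \<noteq> 0" by (simp add: c_def)
      fix s assume s: "s \<in> S"
      have "(\<Sum>i\<le>e (Suc j). c i s * s (Suc j) ^ i) = (\<Sum>i\<in>{0, e (Suc j)}. c i s * s (Suc j) ^ i)"
        by (rule sum.mono_neutral_right) (auto simp: c_def)
      also have "\<dots> = 0" using e[OF j] root[OF j s] by (simp add: c_def)
      finally show "(\<Sum>i\<le>e (Suc j). c i s * s (Suc j) ^ i) = 0" .
    qed
    then obtain y where "a'(Suc j := y) \<in> zclosure (insert (Suc j) ({..j} \<union> K)) S" ..
    moreover have "\<forall>i\<in>K. (a'(Suc j := y)) i = a i" using a'(2) K Suc.prems by auto
    ultimately show ?case unfolding atMost_Suc Un_insert_left by blast
  qed
  then show ?thesis by blast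
qed

text \<open>Regrouped by powers of coordinate 0, the relation has polynomials in \<open>h\<close> of
  degree at most \<open>d\<close> as coefficients. Where the top one does not vanish,
  \<open>zclosure_lift\<close> extends the point, so the exceptions have \<open>h\<close>-values
  among the roots of one polynomial.\<close>

lemma lift_unless_root:
  fixes c :: "nat \<Rightarrow> complex poly"
  assumes K: "0 \<notin> K" and h: "h \<in> polyfun K"
    and c: "\<exists>j\<le>d. c j \<noteq> 0"
    and rel: "\<And>s. s \<in> S \<Longrightarrow> (\<Sum>j\<le>d. poly (c j) (s 0) * h s ^ j) = 0"
  shows "\<exists>L. L \<noteq> 0 \<and> degree L \<le> d \<and> (\<forall>a\<in>zclosure K S. poly L (h a) \<noteq> 0 \<longrightarrow>
      (\<exists>y. a(0 := y) \<in> zclosure (insert 0 K) S))"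
proof -
  \<comment> \<open>\<open>L\<close> is the leading coefficient of the relation as a polynomial in coordinate 0.\<close>
  define N where "N = Max ((\<lambda>j. degree (c j)) ` {j. j \<le> d \<and> c j \<noteq> 0})"
  define L where "L = (\<Sum>j\<le>d. monom (coeff (c j) N) j)"
  have N: "degree (c j) \<le> N" if "j \<le> d" for j
  proof (cases "c j = 0")
    case False
    with that show ?thesis unfolding N_def by (intro Max_ge) auto
  qed simp
  have "N \<in> (\<lambda>j. degree (c j)) ` {j. j \<le> d \<and> c j \<noteq> 0}"
    unfolding N_def using c by (intro Max_in) auto
  then obtain j where j: "j \<le> d" "c j \<noteq> 0" "N = degree (c j)" by auto
  have coeff_L: "coeff L i = (if i \<le> d then coeff (c i) N else 0)" for i
    by (simp add: L_def coeff_sum coeff_monom)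
  \<comment> \<open>A \<open>c j\<close> of maximal degree \<open>N\<close> contributes its leading
    coefficient.\<close>
  have "coeff L j \<noteq> 0" using j by (simp add: coeff_L)
  then have "L \<noteq> 0" by auto
  moreover have "degree L \<le> d" by (rule degree_le) (simp add: coeff_L)
  moreover have "\<exists>y. a(0 := y) \<in> zclosure (insert 0 K) S"
    if a: "a \<in> zclosure K S" "poly L (h a) \<noteq> 0" for a
  proof (rule zclosure_lift[OF a(1) K, of "\<lambda>i v. \<Sum>j\<le>d. coeff (c j) i * h v ^ j" N])
    show "(\<lambda>v. \<Sum>j\<le>d. coeff (c j) i * h v ^ j) \<in> polyfun K" for i
      by (intro polyfun_sum polyfun.mult polyfun.const polyfun_power h)
    show "(\<Sum>j\<le>d. coeff (c j) N * h a ^ j) \<noteq> 0"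
      using a(2) by (simp add: L_def poly_sum poly_monom)
    fix s assume s: "s \<in> S"
    have "poly (c j) x = (\<Sum>i\<le>N. coeff (c j) i * x ^ i)" if "j \<le> d" for j x
      unfolding poly_altdef using N[OF that]
      by (intro sum.mono_neutral_left) (auto simp: coeff_eq_0)
    then have "(\<Sum>j\<le>d. poly (c j) (s 0) * h s ^ j) =
        (\<Sum>j\<le>d. \<Sum>i\<le>N. coeff (c j) i * s 0 ^ i * h s ^ j)"
      by (simp add: sum_distrib_right)
    also have "\<dots> = (\<Sum>i\<le>N. (\<Sum>j\<le>d. coeff (c j) i * h s ^ j) * s 0 ^ i)"
      by (subst sum.swap) (simp add: sum_distrib_left sum_distrib_right mult_ac)
    finally show "(\<Sum>i\<le>N. (\<Sum>j\<le>d. coeff (c j) i * h s ^ j) * s 0 ^ i) = 0"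
      using rel[OF s] by simp
  qed
  ultimately show ?thesis by blast
qed

section \<open>Zariski closures and points that do not lift\<close>

lemma polyfun_rename: "F \<in> polyfun K \<Longrightarrow> f ` K \<subseteq> J \<Longrightarrow> (\<lambda>w. F (\<lambda>i. w (f i))) \<in> polyfun J"
  by (induction rule: polyfun.induct) (auto intro: polyfun.intros)

lemma ev_cong: "mvars f \<subseteq> J \<Longrightarrow> (\<And>i. i \<in> J \<Longrightarrow> v i = w i) \<Longrightarrow> ev v f = ev w f"
  using polyfun_cong[OF ev_in_polyfun] by blast

lemma meval_eq_ev: "meval f a = ev (\<lambda>i. a ! i) f"
  by (simp add: meval_def)

text \<open>The closure is tested against the zero set of a single polynomial. That set consists of
  lists of length \<open>N\<close>, so the length hypothesis is what lets it contain
  \<open>S\<close>.\<close>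

lemma zariski_closureD:
  assumes x: "x \<in> zariski_closure N S" and S: "\<And>s. s \<in> S \<Longrightarrow> length s = N"
  shows "length x = N"
    and "F \<in> polyfun {..<N} \<Longrightarrow> (\<And>s. s \<in> S \<Longrightarrow> F (\<lambda>i. s ! i) = 0) \<Longrightarrow> F (\<lambda>i. x ! i) = 0"
proof -
  have *: "length x = N \<and> meval f x = 0"
    if f: "mvars f \<subseteq> {..<N}" "\<And>s. s \<in> S \<Longrightarrow> meval f s = 0" for f
  proof -
    have "algebraic_set N {a. length a = N \<and> (\<forall>f\<in>{f}. meval f a = 0)}"
      unfolding algebraic_set_def using f(1) by (intro exI[of _ "{f}"]) (auto simp: poly_ring_def)
    then have "algebraic_set N hull S \<subseteq> {a. length a = N \<and> (\<forall>f\<in>{f}. meval f a = 0)}"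
      using f(2) S by (intro hull_minimal) auto
    then show ?thesis using x by (auto simp: zariski_closure_def)
  qed
  \<comment> \<open>The zero polynomial has the whole affine space as its zero set.\<close>
  from *[of 0] show "length x = N" by (simp add: mvars_def meval_eq_ev)
  assume F: "F \<in> polyfun {..<N}" "\<And>s. s \<in> S \<Longrightarrow> F (\<lambda>i. s ! i) = 0"
  from F(1) obtain f where "mvars f \<subseteq> {..<N}" "\<And>v. F v = ev v f" by (rule polyfun_is_ev) blast
  with F(2) *[of f] show "F (\<lambda>i. x ! i) = 0" by (simp add: meval_eq_ev)
qed

text \<open>Any algebraic set containing \<open>S\<close> is cut out by polynomials that vanish on
  \<open>S\<close>, and each of them induces a polynomial function.\<close>

lemma zariski_closureI:
  assumes "length x = N"
    and "\<And>F. F \<in> polyfun {..<N} \<Longrightarrow> (\<And>s. s \<in> S \<Longrightarrow> F (\<lambda>i. s ! i) = 0) \<Longrightarrow> F (\<lambda>i. x ! i) = 0"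
  shows "x \<in> zariski_closure N S"
  unfolding zariski_closure_def hull_def
proof safe
  fix T assume T: "algebraic_set N T" "S \<subseteq> T"
  then obtain A where A: "A \<subseteq> poly_ring N" "T = {a. length a = N \<and> (\<forall>f\<in>A. meval f a = 0)}"
    by (auto simp: algebraic_set_def)
  have "meval f x = 0" if f: "f \<in> A" for f
    unfolding meval_eq_ev
  proof (rule assms(2))
    show "(\<lambda>v. ev v f) \<in> polyfun {..<N}"
      using f A(1) by (intro ev_in_polyfun) (auto simp: poly_ring_def)
    show "ev (\<lambda>i. s ! i) f = 0" if "s \<in> S" for s
      using T(2) A(2) f that by (auto simp: meval_eq_ev)
  qed
  with assms(1) A(2) show "x \<in> T" by simp
qed

text \<open>\<open>l\<close> divides the product of the \<open>q i\<close>, so a zero of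
  \<open>l\<close> is a zero of some \<open>q i\<close>. This supplies the last coordinate of points
  of \<open>D_set\<close>.\<close>

lemma lcm_nonzero:
  assumes lcm: "is_lcm_in (poly_ring N) (q ` I) l" and I: "finite I"
    and q: "\<And>i. i \<in> I \<Longrightarrow> q i \<in> poly_ring N" "\<And>i. i \<in> I \<Longrightarrow> ev v (q i) \<noteq> 0"
  shows "ev v l \<noteq> 0"
proof -
  have "(\<Prod>i\<in>I. q i) \<in> poly_ring N"
    using q(1) mvars_prod[of I q "{..<N}"] by (auto simp: poly_ring_def)
  then have "l dvd (\<Prod>i\<in>I. q i)"
    using lcm I unfolding is_lcm_in_def by (auto intro: dvd_prodI)
  then obtain k where "(\<Prod>i\<in>I. q i) = l * k" ..
  then have "(\<Prod>i\<in>I. ev v (q i)) = ev v l * ev v k" by (simp flip: ev_prod ev_mult)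
  then show ?thesis using q(2) I by auto
qed

text \<open>Points become polynomials with their entries as coefficients; a bad \<open>c\<close> is
  a root of one of finitely many nonzero differences.\<close>

lemma ex_separating_scalar:
  fixes X :: "'a::{idom,ring_char_0} list set"
  assumes "finite X" and len: "\<And>x. x \<in> X \<Longrightarrow> length x = n"
  shows "\<exists>c. inj_on (\<lambda>x. \<Sum>i<n. c ^ i * x ! i) X"
proof -
  define P where "P = (\<lambda>x :: 'a list. \<Sum>i<n. monom (x ! i) i)"
  have coeff_P: "coeff (P x) i = (if i < n then x ! i else 0)" for x i
    by (simp add: P_def coeff_sum coeff_monom)
  have P: "P x \<noteq> P y" if "x \<in> X" "y \<in> X" "x \<noteq> y" for x y
  proof
    assume "P x = P y"
    then have "x ! i = y ! i" if "i < n" for i using coeff_P[of x i] coeff_P[of y i] that by simp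
    with that len show False by (metis nth_equalityI)
  qed
  have "finite (\<Union>(x, y)\<in>{(x, y). x \<in> X \<and> y \<in> X \<and> x \<noteq> y}. {c. poly (P x - P y) c = 0})"
  proof (intro finite_UN_I)
    show "finite {(x, y). x \<in> X \<and> y \<in> X \<and> x \<noteq> y}"
      by (rule finite_subset[of _ "X \<times> X"]) (use assms(1) in auto)
    show "finite (case z of (x, y) \<Rightarrow> {c. poly (P x - P y) c = 0})"
      if "z \<in> {(x, y). x \<in> X \<and> y \<in> X \<and> x \<noteq> y}" for z
      using that P by (auto simp del: poly_diff intro!: poly_roots_finite)
  qed
  then obtain c where c: "c \<notin> (\<Union>(x, y)\<in>{(x, y). x \<in> X \<and> y \<in> X \<and> x \<noteq> y}. {c. poly (P x - P y) c = 0})"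
    using ex_new_if_finite[OF infinite_UNIV_char_0] by blast
  have separates: "poly (P x) c \<noteq> poly (P y) c" if "x \<in> X" "y \<in> X" "x \<noteq> y" for x y
  proof
    assume "poly (P x) c = poly (P y) c"
    with that have "c \<in> (\<Union>(x, y)\<in>{(x, y). x \<in> X \<and> y \<in> X \<and> x \<noteq> y}. {c. poly (P x - P y) c = 0})"
      by (intro UN_I[of "(x, y)"]) auto
    with c show False by (rule notE)
  qed
  have "poly (P x) c = (\<Sum>i<n. c ^ i * x ! i)" for x
    by (simp add: P_def poly_sum poly_monom mult.commute)
  then have "x = y" if "x \<in> X" "y \<in> X" "(\<Sum>i<n. c ^ i * x ! i) = (\<Sum>i<n. c ^ i * y ! i)" for x y
    using separates[OF that(1,2)] that(3) by auto
  then show ?thesis by (intro exI[of _ c] inj_onI)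
qed

section \<open>Counting the points that do not lift\<close>

theorem mainTheorem5:
  fixes \<iota> :: "complex poly fract \<Rightarrow> 'a::field"
    and \<delta> :: "nat \<Rightarrow> 'a"
    and m n :: nat
    and e \<epsilon> :: "nat \<Rightarrow> nat"
    and g p q E :: "nat \<Rightarrow> mpoly_cx"
    and l :: mpoly_cx
    and U :: "complex list set"
  assumes param: "radical_curve_parametrization \<iota> m e \<delta> n g p q"
    and lcm: "is_lcm_in (poly_ring (m + 1)) (q ` {1..n}) l"
  defines "E \<equiv> defpoly e g"
    and "\<epsilon> \<equiv> \<lambda>i. max (e i) (mtotal_degree (g i))"
    and "U \<equiv> {x \<in> zariski_closure n (X_set m n E p q).
                \<nexists>t \<Delta>. length \<Delta> = m \<and> t # \<Delta> @ x \<in> A_set m n E p q l}"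
  shows "finite U \<and> card U \<le> (\<Prod>i = 1..m. \<epsilon> i)"
proof -
  interpret radical_curve_parametrization \<iota> m e \<delta> n g p q by (fact param)
  define d where "d = (\<Prod>i = 1..m. e i)"
  \<comment> \<open>Coordinate 0 is the parameter, 1 to \<open>m\<close> are the radicals, and
    \<open>K\<close> holds the point \<open>x\<close>, whose list entry \<open>i - 1\<close> sits at
    \<open>m + i\<close>. \<open>S\<close> is the graph of the parametrization; \<open>emb x\<close>
    is meaningful only on \<open>K\<close>.\<close>
  define K where "K = {m<..m + n}"
  define emb where "emb = (\<lambda>(x :: complex list) i. x ! (i - (m + 1)))"
  define S where "S = {v. (\<forall>i\<in>{1..m}. ev v (E i) = 0) \<and>
    (\<forall>i\<in>{1..n}. ev v (q i) \<noteq> 0 \<and> ev v (p i) / ev v (q i) = v (m + i))}"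
  have mvars_g: "mvars (g i) \<subseteq> {..<i}" if "i \<in> {1..m}" for i
    using g_ring[OF that] by (simp add: poly_ring_def)
  have mvars_pq: "mvars (p i) \<subseteq> {..m}" "mvars (q i) \<subseteq> {..m}" if "i \<in> {1..n}" for i
    using p_ring[OF that] q_ring[OF that] by (simp_all add: poly_ring_def lessThan_Suc_atMost)
  have ev_E: "ev v (E i) = v i ^ e i - ev v (g i)" for v i
    by (simp add: E_def defpoly_def ev_diff ev_power)
  have root: "s i ^ e i = ev s (g i)" if "i \<in> {1..m}" "s \<in> S" for i s
    using that by (auto simp: S_def ev_E)
  have g_polyfun: "(\<lambda>v. ev v (g i)) \<in> polyfun {..<i}" if "i \<in> {1..m}" for i
    using mvars_g[OF that] by (rule ev_in_polyfun)
  have E_cong: "ev v (E i) = ev w (E i)" if "i \<in> {1..m}" "\<And>i. i \<le> m \<Longrightarrow> v i = w i" for v w i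
    unfolding ev_E using that by (auto intro!: arg_cong2[where f = "(-)"] ev_cong[OF mvars_g])
  have pq_cong: "ev v (p i) = ev w (p i)" "ev v (q i) = ev w (q i)"
    if "i \<in> {1..n}" "\<And>i. i \<le> m \<Longrightarrow> v i = w i" for v w i
    using that by (auto intro!: ev_cong[OF mvars_pq(1)] ev_cong[OF mvars_pq(2)])

  \<comment> \<open>Every point of \<open>X_set\<close> is the \<open>K\<close>-part of a point of
    the graph, so a function of the coordinates in \<open>K\<close> that vanishes on
    \<open>S\<close> also vanishes on the closure of \<open>X_set\<close>.\<close>
  have emb_closure: "length x = n" "emb x \<in> zclosure K S"
    if x: "x \<in> zariski_closure n (X_set m n E p q)" for x
  proof -
    have len: "length s = n" if "s \<in> X_set m n E p q" for s
      using that by (simp add: X_set_def)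
    show "length x = n" by (rule zariski_closureD(1)[OF x len])
    show "emb x \<in> zclosure K S"
      unfolding zclosure_def
    proof safe
      fix F assume F: "F \<in> polyfun K" "\<forall>s\<in>S. F s = 0"
      have F': "(\<lambda>w. F (\<lambda>i. w (i - (m + 1)))) \<in> polyfun {..<n}"
        using F(1) by (rule polyfun_rename) (auto simp: K_def)
      have "F (\<lambda>i. s ! (i - (m + 1))) = 0" if "s \<in> X_set m n E p q" for s
      proof -
        from that obtain t \<Delta> where s: "length s = n" "length \<Delta> = m"
          "\<forall>i\<in>{1..m}. meval (E i) (t # \<Delta>) = 0"
          "\<forall>i\<in>{1..n}. meval (q i) (t # \<Delta>) \<noteq> 0"
          "\<forall>i\<in>{1..n}. meval (p i) (t # \<Delta>) / meval (q i) (t # \<Delta>) = s ! (i - 1)"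
          by (auto simp: X_set_def)
        define v where "v = (\<lambda>i. (t # \<Delta> @ s) ! i)"
        have v: "v i = (t # \<Delta>) ! i" if "i \<le> m" for i
          using that s(2) nth_append_left[of i "t # \<Delta>" s] by (simp add: v_def)
        have v_emb: "v i = s ! (i - (m + 1))" if "i \<in> K" for i
          using that s(2) nth_append_right[of "t # \<Delta>" i s] by (simp add: v_def K_def)
        have "v \<in> S"
          unfolding S_def
        proof (intro CollectI conjI ballI)
          fix i assume i: "i \<in> {1..m}"
          then show "ev v (E i) = 0"
            using s(3) E_cong[OF i v] by (simp add: meval_eq_ev)
        next
          fix i assume i: "i \<in> {1..n}"
          show "ev v (q i) \<noteq> 0"
            using i s(4) pq_cong(2)[OF i v] by (simp add: meval_eq_ev)
          have "v (m + i) = s ! (i - 1)" using i v_emb[of "m + i"] by (simp add: K_def)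
          then show "ev v (p i) / ev v (q i) = v (m + i)"
            using i s(5) pq_cong[OF i v] by (simp add: meval_eq_ev)
        qed
        then have "F v = 0" using F(2) by blast
        moreover have "F (\<lambda>i. s ! (i - (m + 1))) = F v"
          using F(1) by (rule polyfun_cong) (simp add: v_emb)
        ultimately show ?thesis by simp
      qed
      then show "F (emb x) = 0"
        using zariski_closureD(2)[OF x len F'] by (simp add: emb_def)
    qed
  qed

  \<comment> \<open>A polynomial vanishing on the projection of \<open>D_set\<close> vanishes on
    \<open>S\<close>, hence at \<open>a\<close>; the values of \<open>a\<close> at 0 to
    \<open>m\<close> followed by \<open>x\<close> therefore form a point of
    \<open>A_set\<close>.\<close>
  have lifts: "x \<notin> U"
    if len: "length x = n" and a: "a \<in> zclosure ({..m} \<union> K) S" "\<And>i. i \<in> K \<Longrightarrow> a i = emb x i" for x a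
  proof -
    have "{..m} \<union> K = {..<m + n + 1}" by (auto simp: K_def)
    note a = a(1)[unfolded this] a(2)
    define pt where "pt = (\<lambda>v (y :: complex list). v 0 # map v [1..<m + 1] @ y)"
    have pt_nth: "pt v y ! i = v i"
      if "length y = n" "\<And>i. i \<in> K \<Longrightarrow> v i = emb y i" "i < m + n + 1" for v y i
    proof -
      let ?w = "v 0 # map v [1..<m + 1]"
      have pt: "pt v y = ?w @ y" by (simp add: pt_def)
      show ?thesis
      proof (cases "i \<le> m")
        case True
        then have "pt v y ! i = ?w ! i" unfolding pt by (intro nth_append_left) simp
        with True show ?thesis by (cases i) (simp_all del: upt_Suc)
      next
        case False
        then have "pt v y ! i = y ! (i - length ?w)" unfolding pt by (intro nth_append_right) simp
        with False that show ?thesis by (simp add: K_def emb_def del: upt_Suc)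
      qed
    qed
    have "pt a x \<in> A_set m n E p q l"
      unfolding A_set_def
    proof (rule zariski_closureI)
      show "length (pt a x) = m + n + 1" by (simp add: pt_def len)
      fix F assume F: "F \<in> polyfun {..<m + n + 1}"
        "\<And>s. s \<in> butlast ` D_set m n E p q l \<Longrightarrow> F (\<lambda>i. s ! i) = 0"
      have "F v = 0" if v: "v \<in> S" for v
      proof -
        define y where "y = map (\<lambda>i. v (m + 1 + i)) [0..<n]"
        have y: "length y = n" "\<And>i. i \<in> K \<Longrightarrow> v i = emb y i"
          by (auto simp: y_def emb_def K_def)
        define \<Delta> where "\<Delta> = map v [1..<m + 1]"
        have \<Delta>: "length \<Delta> = m" "\<And>i. i \<le> m \<Longrightarrow> (v 0 # \<Delta>) ! i = v i"
          by (auto simp: \<Delta>_def nth_Cons simp del: upt_Suc split: nat.split)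
        have "ev v l \<noteq> 0"
          using lcm by (rule lcm_nonzero) (use v q_ring in \<open>auto simp: S_def\<close>)
        moreover have "ev v l = meval l (v 0 # \<Delta>)"
          unfolding meval_eq_ev using lcm \<Delta>(2)
          by (intro ev_cong[of l "{..m}"]) (auto simp: is_lcm_in_def poly_ring_def lessThan_Suc_atMost)
        ultimately have "meval l (v 0 # \<Delta>) \<noteq> 0" by simp
        moreover have "meval (E i) (v 0 # \<Delta>) = 0" if "i \<in> {1..m}" for i
          using v that E_cong[OF that \<Delta>(2)] by (simp add: meval_eq_ev S_def)
        moreover have "meval (p i) (v 0 # \<Delta>) - y ! (i - 1) * meval (q i) (v 0 # \<Delta>) = 0"
          if i: "i \<in> {1..n}" for i
        proof -
          have "ev v (q i) \<noteq> 0" "ev v (p i) / ev v (q i) = v (m + i)" "y ! (i - 1) = v (m + i)"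
            using v i by (auto simp: S_def y_def)
          then show ?thesis
            using pq_cong[OF i \<Delta>(2)] by (auto simp: meval_eq_ev field_simps)
        qed
        ultimately have "v 0 # \<Delta> @ y @ [1 / meval l (v 0 # \<Delta>)] \<in> D_set m n E p q l"
          unfolding D_set_def using \<Delta>(1) y(1)
          by (intro CollectI exI[of _ "v 0"] exI[of _ \<Delta>] exI[of _ y]
              exI[of _ "1 / meval l (v 0 # \<Delta>)"]) simp
        then have "butlast (v 0 # \<Delta> @ y @ [1 / meval l (v 0 # \<Delta>)]) \<in> butlast ` D_set m n E p q l"
          by (rule imageI)
        then have "pt v y \<in> butlast ` D_set m n E p q l"
          by (simp add: pt_def \<Delta>_def butlast_append)
        then have "F (\<lambda>i. pt v y ! i) = 0" by (rule F(2))
        moreover have "F (\<lambda>i. pt v y ! i) = F v"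
          using F(1) by (rule polyfun_cong) (use pt_nth[of y v] y in auto)
        ultimately show ?thesis by simp
      qed
      then have "F a = 0" by (rule zclosureD[OF a(1) F(1)])
      moreover have "F (\<lambda>i. pt a x ! i) = F a"
        using F(1) by (rule polyfun_cong) (use pt_nth[of x a] len a(2) in auto)
      ultimately show "F (\<lambda>i. pt a x ! i) = 0" by simp
    qed
    moreover have "length (map a [1..<m + 1]) = m" by simp
    ultimately show ?thesis unfolding U_def pt_def by blast
  qed

  \<comment> \<open>The separating scalar, and with it \<open>L\<close>, depends on a finite set
    \<open>T\<close>. Bounding all finite subsets of \<open>U\<close> by the same \<open>d\<close>
    gives finiteness of \<open>U\<close> as well.\<close>
  have "card T \<le> d" if T: "T \<subseteq> U" "finite T" for T
  proof -
    have T_closure: "x \<in> zariski_closure n (X_set m n E p q)" if "x \<in> T" for x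
      using that T(1) by (auto simp: U_def)
    then obtain c :: complex where inj: "inj_on (\<lambda>x. \<Sum>i<n. c ^ i * x ! i) T"
      using ex_separating_scalar[OF T(2), of n] emb_closure(1) by blast
    define h where "h = (\<lambda>v. \<Sum>i<n. c ^ i * v (m + 1 + i))"
    have h: "h \<in> polyfun K"
      unfolding h_def
      by (intro polyfun_sum polyfun.mult polyfun.const polyfun.var) (auto simp: K_def)
    \<comment> \<open>Common denominators: on \<open>S\<close> the linear form \<open>h\<close>
      equals \<open>A / B\<close>, with \<open>A\<close> and \<open>B\<close> reading only the
      parameter and the radicals.\<close>
    define A where "A = (\<lambda>v. \<Sum>i<n. c ^ i * (ev v (p (i + 1)) * (\<Prod>k\<in>{1..n} - {i + 1}. ev v (q k))))"
    define B where "B = (\<lambda>v. \<Prod>k\<in>{1..n}. ev v (q k))"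
    have AB: "A \<in> polyfun {..m}" "B \<in> polyfun {..m}"
      unfolding A_def B_def
      by (intro polyfun_sum polyfun.mult polyfun.const polyfun_prod ev_in_polyfun mvars_pq; force)+
    have hB: "A s = h s * B s" and B_nz: "B s \<noteq> 0" if s: "s \<in> S" for s
    proof -
      show "B s \<noteq> 0" using s by (auto simp: S_def B_def)
      have "ev s (p (i + 1)) * (\<Prod>k\<in>{1..n} - {i + 1}. ev s (q k)) = s (m + 1 + i) * B s" if "i < n" for i
      proof -
        have i: "i + 1 \<in> {1..n}" using that by auto
        then have "ev s (p (i + 1)) = s (m + 1 + i) * ev s (q (i + 1))"
          using s unfolding S_def by (fastforce simp: field_simps)
        moreover have "B s = ev s (q (i + 1)) * (\<Prod>k\<in>{1..n} - {i + 1}. ev s (q k))"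
          unfolding B_def using i by (intro prod.remove) auto
        ultimately show ?thesis by simp
      qed
      then show "A s = h s * B s"
        by (simp add: A_def h_def sum_distrib_right mult.assoc)
    qed
    obtain F where F: "\<exists>j\<le>d. F j \<noteq> 0"
      "\<And>s. s \<in> S \<Longrightarrow> (\<Sum>j\<le>d. poly (F j) (s 0) * (A s ^ j * B s ^ (d - j))) = 0"
      using tower_algebraic_relation[of m e "\<lambda>i v. ev v (g i)" S, OF exponent_pos g_polyfun root AB]
      unfolding d_def by blast
    \<comment> \<open>As \<open>A = h * B\<close> on \<open>S\<close>, every term carries the
      nonzero factor \<open>B ^ d\<close>.\<close>
    have rel: "(\<Sum>j\<le>d. poly (F j) (s 0) * h s ^ j) = 0" if s: "s \<in> S" for s
    proof -
      have "poly (F j) (s 0) * (A s ^ j * B s ^ (d - j)) = poly (F j) (s 0) * h s ^ j * B s ^ d"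
        if "j \<le> d" for j
        using that hB[OF s] by (simp add: power_mult_distrib flip: power_add)
      then have "(\<Sum>j\<le>d. poly (F j) (s 0) * (A s ^ j * B s ^ (d - j))) =
          (\<Sum>j\<le>d. poly (F j) (s 0) * h s ^ j) * B s ^ d"
        unfolding sum_distrib_right by (intro sum.cong refl) auto
      then have "(\<Sum>j\<le>d. poly (F j) (s 0) * h s ^ j) * B s ^ d = 0"
        using F(2)[OF s] by simp
      with B_nz[OF s] show ?thesis by simp
    qed
    have "0 \<notin> K" by (simp add: K_def)
    then have "\<exists>L. L \<noteq> 0 \<and> degree L \<le> d \<and> (\<forall>a\<in>zclosure K S. poly L (h a) \<noteq> 0 \<longrightarrow>
        (\<exists>y. a(0 := y) \<in> zclosure (insert 0 K) S))"
      by (rule lift_unless_root[OF _ h F(1)]) (rule rel)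
    then obtain L where L: "L \<noteq> 0" "degree L \<le> d" and lift: "\<forall>a\<in>zclosure K S.
        poly L (h a) \<noteq> 0 \<longrightarrow> (\<exists>y. a(0 := y) \<in> zclosure (insert 0 K) S)"
      by (elim exE conjE)
    \<comment> \<open>Otherwise coordinate 0 lifts, then all radicals by \<open>tower_lift\<close>,
      and \<open>lifts\<close> contradicts membership of \<open>x\<close> in
      \<open>U\<close>.\<close>
    have "poly L (h (emb x)) = 0" if x: "x \<in> T" for x
    proof (rule ccontr)
      assume "poly L (h (emb x)) \<noteq> 0"
      then obtain y where y: "(emb x)(0 := y) \<in> zclosure (insert 0 K) S"
        using bspec[OF lift emb_closure(2)[OF T_closure[OF x]]] by (elim impE exE)
      have "K \<inter> {..m} = {}" by (auto simp: K_def)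
      then have "\<exists>a\<in>zclosure ({..m} \<union> K) S. \<forall>i\<in>K. a i = ((emb x)(0 := y)) i"
        using exponent_pos g_polyfun root y by (intro tower_lift[of m e "\<lambda>i v. ev v (g i)" S])
      then obtain a where "a \<in> zclosure ({..m} \<union> K) S" "\<forall>i\<in>K. a i = ((emb x)(0 := y)) i"
        by (elim bexE)
      then have "x \<notin> U"
        using emb_closure(1)[OF T_closure[OF x]] by (intro lifts[of x a]) (auto simp: K_def)
      with x T(1) show False by blast
    qed
    moreover have "h (emb x) = (\<Sum>i<n. c ^ i * x ! i)" for x
      by (simp add: h_def emb_def)
    ultimately have "(\<lambda>x. \<Sum>i<n. c ^ i * x ! i) ` T \<subseteq> {z. poly L z = 0}" by auto
    \<comment> \<open>The separating form injects \<open>T\<close> into the roots of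
      \<open>L\<close>.\<close>
    then have "card T \<le> card {z. poly L z = 0}"
      using card_inj_on_le[OF inj] poly_roots_finite[OF L(1)] by blast
    also have "\<dots> \<le> d"
      using card_poly_roots_bound[OF L(1)] L(2) by simp
    finally show ?thesis .
  qed
  then have "finite U \<and> card U \<le> d" by (rule finite_if_finite_subsets_card_bdd)
  moreover have "d \<le> (\<Prod>i = 1..m. \<epsilon> i)"
    unfolding d_def \<epsilon>_def by (intro prod_mono) auto
  ultimately show ?thesis by simp
qed

end
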